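(* Let $d\ge2$, let $0<\lambda<\lambda_c$, let $X$ be a homogeneous Poisson point process in $\mathbb{R}^d$ with intensity $\lambda$, and let $Y^{(1)}$ be a stationary and ergodic point process in $\mathbb{R}^d$, independent of $X$, with intensity $\lambda'\in(0,\infty)$. Let $r>0$. Then $$\sup_{k\ge1}\Theta(k,r)\le\lambda^{-1}r^{-d}\lambda'\,\mathbb{E}\,\#C(o),$$ where $C(o)$ denotes the set of all $X_i\in X$ that are connectable to the origin $o$.
   Context: Point processes are regarded as random locally finite subsets of $\mathbb{R}^d$; $|\cdot|$ is the Euclidean norm. The critical intensity $\lambda_c$ is the infimum over all intensities $\lambda>0$ for which the union $\bigcup_{i}B_{1/2}(X_i)$ of balls of radius $1/2$ centered at the points $X_i$ of a homogeneous Poisson point process of intensity $\lambda$ in $\mathbb{R}^d$ almost surely has an unbounded connected component. Put $Y=rY^{(1)}=\{ry:y\in Y^{(1)}\}$. For an integer $k\ge1$, two points $x,y\in\mathbb{R}^d$ are $k$-connectable if there exist (not necessarily distinct) $X_{i_1},\ldots,X_{i_{k-1}}\in X$ such that $|X_{i_j}-X_{i_{j+1}}|\le1$ for all $j\in\{0,\ldots,k-1\}$, where $X_{i_0}=x$ and $X_{i_k}=y$. They are connectable if they are $k$-connectable for some $k\ge1$. For $x\in\mathbb{R}^d$, $H_r(x)$ is the smallest $k\ge1$ such that $x$ is $k$-connectable to some point of $Y=rY^{(1)}$ ($H_r(x)=\infty$ if there is no such $k$). Finally, $$\Theta(k,r)=\lambda^{-1}\,\mathbb{E}\,\#\{X_i\in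 X\cap[-1/2,1/2]^d:\ H_r(X_i)\le k\}.$$ *)

theory Defs
  imports "HOL-Probability.Probability"
begin

definition locally_finite :: "'a::metric_space set \<Rightarrow> bool" where
  "locally_finite A \<longleftrightarrow> (\<forall>B. bounded B \<longrightarrow> finite (A \<inter> B))"

text \<open>The measurable space of point configurations: locally finite sets, with the \<sigma>-algebra
  generated by the counting maps of bounded Borel sets. For locally finite sets and bounded
  test sets, \<^const>\<open>card\<close> is the true number of points; wherever a set may be infinite, we count
  with \<open>num_points\<close>, which takes values in \<^typ>\<open>ennreal\<close>.\<close>

definition config_space :: "'a::{metric_space, second_countable_topology} set measure" where
  "config_space = sigma {A. locally_finite A}
     {{A. locally_finite A \<and> card (A \<inter> B) = k} | B k. B \<in> sets borel \<and> bounded B}"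

definition num_points :: "'a set \<Rightarrow> ennreal" where
  "num_points A = emeasure (count_space UNIV) A"

definition point_process :: "'w measure \<Rightarrow> ('w \<Rightarrow> (real ^ 'n) set) \<Rightarrow> bool" where
  "point_process M X \<longleftrightarrow> prob_space M \<and> X \<in> measurable M config_space"

definition poisson_process :: "'w measure \<Rightarrow> real \<Rightarrow> ('w \<Rightarrow> (real ^ 'n) set) \<Rightarrow> bool" where
  "poisson_process M lam X \<longleftrightarrow>
     point_process M X \<and>
     (\<forall>B k. B \<in> sets borel \<and> bounded B \<longrightarrow>
        measure M {w \<in> space M. card (X w \<inter> B) = k} =
          (lam * measure lborel B) ^ k / fact k * exp (- (lam * measure lborel B))) \<and>
     (\<forall>(n::nat) B. (\<forall>i<n. B i \<in> sets borel \<and> bounded (B i)) \<and> disjoint_family_on B {..<n} \<longrightarrow>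
        prob_space.indep_vars M (\<lambda>_. count_space UNIV) (\<lambda>i w. card (X w \<inter> B i)) {..<n})"

definition stationary :: "'w measure \<Rightarrow> ('w \<Rightarrow> (real ^ 'n) set) \<Rightarrow> bool" where
  "stationary M X \<longleftrightarrow>
     (\<forall>v. distr M config_space (\<lambda>w. (+) v ` X w) = distr M config_space X)"

definition ergodic :: "'w measure \<Rightarrow> ('w \<Rightarrow> (real ^ 'n) set) \<Rightarrow> bool" where
  "ergodic M X \<longleftrightarrow>
     (\<forall>E \<in> sets config_space. (\<forall>v. {A \<in> space config_space. (+) v ` A \<in> E} = E) \<longrightarrow>
        measure M {w \<in> space M. X w \<in> E} \<in> {0, 1})"

text \<open>The intensity of a stationary point process: the mean number of points in a unit cube.\<close>

definition intensity :: "'w measure \<Rightarrow> ('w \<Rightarrow> (real ^ 'n) set) \<Rightarrow> ennreal" where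
  "intensity M X = (\<integral>\<^sup>+ w. num_points (X w \<inter> cbox (\<chi> i. 0) (\<chi> i. 1)) \<partial>M)"

definition percolates :: "(real ^ 'n) set \<Rightarrow> bool" where
  "percolates A \<longleftrightarrow> (\<exists>C \<in> components (\<Union>x\<in>A. cball x (1/2)). \<not> bounded C)"

text \<open>A Poisson process is realised here canonically, as the identity map on the configuration
  space equipped with its law \<open>P\<close>; that law exists and is determined by the intensity, so there is
  no difference between asking for some or for all such \<open>P\<close>. The infimum is taken in
  \<^typ>\<open>ereal\<close>, so that the infimum of the empty set is \<open>\<infinity>\<close>.\<close>

definition critical_intensity :: "'n::finite itself \<Rightarrow> ereal" where
  "critical_intensity _ = Inf {ereal lam | lam. 0 < lam \<and>
     (\<exists>P :: (real ^ 'n) set measure. sets P = sets config_space \<and>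
        poisson_process P lam (\<lambda>A. A) \<and> (AE A in P. percolates A))}"

definition k_connectable :: "(real ^ 'n) set \<Rightarrow> nat \<Rightarrow> real ^ 'n \<Rightarrow> real ^ 'n \<Rightarrow> bool" where
  "k_connectable X k x y \<longleftrightarrow> k \<ge> 1 \<and>
     (\<exists>z. z 0 = x \<and> z k = y \<and> (\<forall>j \<in> {1..<k}. z j \<in> X) \<and>
        (\<forall>j<k. norm (z j - z (Suc j)) \<le> 1))"

definition connectable :: "(real ^ 'n) set \<Rightarrow> real ^ 'n \<Rightarrow> real ^ 'n \<Rightarrow> bool" where
  "connectable X x y \<longleftrightarrow> (\<exists>k\<ge>1. k_connectable X k x y)"

definition cluster :: "(real ^ 'n) set \<Rightarrow> real ^ 'n \<Rightarrow> (real ^ 'n) set" where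
  "cluster X x = {y \<in> X. connectable X y x}"

text \<open>The number \<open>H\<^sub>r(x)\<close> of hops from \<open>x\<close> to \<open>Y = rY1\<close>; the infimum of the empty set in
  \<^typ>\<open>enat\<close> is \<open>\<infinity>\<close>.\<close>

definition hops :: "(real ^ 'n) set \<Rightarrow> (real ^ 'n) set \<Rightarrow> real \<Rightarrow> real ^ 'n \<Rightarrow> enat" where
  "hops X Y1 r x =
     Inf {enat k | k. k \<ge> 1 \<and> (\<exists>y \<in> (\<lambda>y. r *\<^sub>R y) ` Y1. k_connectable X k x y)}"

definition Theta ::
  "'w measure \<Rightarrow> real \<Rightarrow> ('w \<Rightarrow> (real ^ 'n) set) \<Rightarrow> ('w \<Rightarrow> (real ^ 'n) set) \<Rightarrow> nat \<Rightarrow> real \<Rightarrow> ennreal"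
where
  "Theta M lam X Y1 k r = ennreal (inverse lam) *
     (\<integral>\<^sup>+ w. num_points {x \<in> X w \<inter> cbox (\<chi> i. - 1/2) (\<chi> i. 1/2).
        hops (X w) (Y1 w) r x \<le> enat k} \<partial>M)"

end

theory Submission
  imports Defs
begin

text \<open>Mass transport: every counted point of \<open>X\<close> in the unit cube is connectable to some point of
  \<open>r Y\<^sup>1\<close>, so \<open>\<lambda> \<Theta>(k, r)\<close> is at most the expected number of pairs \<open>(x, y)\<close> of connectable points. By
  independence and Campbell's formula for the stationary process \<open>Y\<^sup>1\<close>, that number is
  \<open>\<lambda>' r\<^sup>-\<^sup>d\<close> times the Lebesgue integral over \<open>y\<close> of the expected number of points of \<open>X\<close> in the cube
  connectable to \<open>y\<close>. Shifting \<open>X\<close> by \<open>-y\<close> moves \<open>y\<close> to the origin and the cube over the whole space, so the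
  integral equals the expected size of the cluster of the origin. All functionals involved are
  measurable since the points of a configuration can be enumerated measurably.\<close>

section \<open>The measurable space of configurations\<close>

lemma space_config_space: "space config_space = {A. locally_finite A}"
  unfolding config_space_def by (rule space_measure_of) auto

text \<open>Measurability into a generated sigma-algebra need only be tested on the generators. Once
  all values are locally finite, the preimages of the generators are exactly the counting events on
  the right.\<close>

lemma measurable_config_space_iff:
  fixes f :: "'w \<Rightarrow> 'a::{metric_space, second_countable_topology} set"
  shows "f \<in> measurable M config_space \<longleftrightarrow>
    (\<forall>w\<in>space M. locally_finite (f w)) \<and>
    (\<forall>B k. B \<in> sets borel \<and> bounded B \<longrightarrow> {w \<in> space M. card (f w \<inter> B) = k} \<in> sets M)"
    (is "_ \<longleftrightarrow> ?lf \<and> ?card")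
proof (cases ?lf)
  case True
  have "f \<in> measurable M config_space \<longleftrightarrow>
    (\<forall>A\<in>{{A. locally_finite A \<and> card (A \<inter> B) = k} | B k. B \<in> sets borel \<and> bounded B}.
      f -` A \<inter> space M \<in> sets M)"
    unfolding config_space_def using True by (intro measurable_iff_measure_of) auto
  also have "\<dots> \<longleftrightarrow> (\<forall>B k. B \<in> sets borel \<and> bounded B \<longrightarrow>
      f -` {A. locally_finite A \<and> card (A \<inter> B) = k} \<inter> space M \<in> sets M)"
    by blast
  also have "(\<lambda>B k. f -` {A. locally_finite A \<and> card (A \<inter> B) = k} \<inter> space M) =
      (\<lambda>B k. {w \<in> space M. card (f w \<inter> B) = k})"
    using True by (intro ext) auto
  finally show ?thesis using True by simp
next
  case False
  then show ?thesis
    using measurable_space[of f M config_space] by (auto simp: space_config_space)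
qed

lemma pred_card_eq:
  assumes "f \<in> measurable M config_space" "B \<in> sets borel" "bounded B"
  shows "{w \<in> space M. card (f w \<inter> B) = k} \<in> sets M"
  using assms by (auto simp: measurable_config_space_iff)

lemma measurable_card:
  assumes "f \<in> measurable M config_space" "B \<in> sets borel" "bounded B"
  shows "(\<lambda>w. card (f w \<inter> B)) \<in> measurable M (count_space UNIV)"
proof -
  have "(\<lambda>w. card (f w \<inter> B)) -` {k} \<inter> space M \<in> sets M" for k
    using pred_card_eq[OF assms, of k] by (simp add: vimage_def Int_def conj_commute)
  then show ?thesis
    by (simp add: measurable_count_space_eq2_countable)
qed

section \<open>Countability and measurable enumeration of the points of a configuration\<close>

lemma countable_locally_finite:
  assumes "locally_finite A"
  shows "countable A"
proof (cases "A = {}")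
  case False
  then obtain a where "a \<in> A" by auto
  have "A = (\<Union>n::nat. A \<inter> ball a (real n))"
    by (auto simp: dist_commute intro: reals_Archimedean2)
  moreover have "finite (A \<inter> ball a (real n))" for n
    using assms by (simp add: locally_finite_def)
  ultimately show ?thesis
    by (metis countable_UN countableI_type countable_finite)
qed simp

text \<open>A basis element inside a ball is bounded, so the bounded members of a countable basis
  still refine every ball. Boundedness matters because \<open>config_space\<close> only provides
  counts in bounded sets.\<close>

lemma bounded_base:
  obtains U :: "nat \<Rightarrow> 'a::{metric_space, second_countable_topology} set"
  where "\<And>i. open (U i)" "\<And>i. bounded (U i)"
    "\<And>x e. 0 < e \<Longrightarrow> \<exists>i. x \<in> U i \<and> U i \<subseteq> ball x e"
proof -
  obtain B :: "'a set set" where B: "countable B" "topological_basis B"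
    using ex_countable_basis by blast
  \<comment> \<open>The empty set keeps \<open>C\<close> nonempty, so that
    \<open>from_nat_into\<close> enumerates exactly \<open>C\<close>.\<close>
  define C where "C = insert {} {U \<in> B. bounded U}"
  have "countable C" "C \<noteq> {}" using B by (auto simp: C_def)
  then have C: "range (from_nat_into C) = C" by (simp add: range_from_nat_into)
  have "V \<in> C \<Longrightarrow> open V \<and> bounded V" for V
    using B by (auto simp: C_def topological_basis_open)
  then have 1: "open (from_nat_into C i)" "bounded (from_nat_into C i)" for i
    using C by auto
  have "\<exists>i. x \<in> from_nat_into C i \<and> from_nat_into C i \<subseteq> ball x e" if "0 < e" for x :: 'a and e
  proof -
    obtain V where "V \<in> B" "x \<in> V" "V \<subseteq> ball x e"
      using topological_basisE[OF B(2), of "ball x e" x] \<open>0 < e\<close> by auto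
    moreover then have "V \<in> C"
      using bounded_subset[OF bounded_ball] by (auto simp: C_def)
    ultimately show ?thesis using C by (metis imageE)
  qed
  with 1 show ?thesis by (rule that)
qed

text \<open>Points of a locally finite set are isolated, so each is the only point in some
  \<open>U i\<close>. The purpose is to turn sums over a random set into series over a fixed index
  set, with \<open>pt i\<close> the candidate point and \<open>sel i\<close> telling whether index
  \<open>i\<close> is used.\<close>

lemma measurable_enumeration:
  obtains pt :: "nat \<Rightarrow> 'a::{metric_space, second_countable_topology} set \<Rightarrow> 'a" and sel
  where "\<And>i. pt i \<in> measurable config_space borel"
    "\<And>i. Measurable.pred config_space (sel i)"
    "\<And>A. locally_finite A \<Longrightarrow> bij_betw (\<lambda>i. pt i A) {i. sel i A} A"
proof -
  obtain U :: "nat \<Rightarrow> 'a set" where U: "\<And>i. open (U i)" "\<And>i. bounded (U i)"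
    "\<And>x e. 0 < e \<Longrightarrow> \<exists>i. x \<in> U i \<and> U i \<subseteq> ball x e"
    using bounded_base by blast
  \<comment> \<open>The default is a constant, so its preimages are everything or nothing; it never
    enters the enumeration because \<open>sel i\<close> forces the count to be 1.\<close>
  define pt where "pt i A = (if card (A \<inter> U i) = 1 then the_elem (A \<inter> U i) else undefined)" for i A
  \<comment> \<open>Every point is alone in some basic set; it is counted only for the first such set.\<close>
  define sel where
    "sel i A \<longleftrightarrow> card (A \<inter> U i) = 1 \<and> (\<forall>j<i. card (A \<inter> U j) = 1 \<longrightarrow> pt j A \<noteq> pt i A)" for i A
  have [measurable]: "Measurable.pred config_space (\<lambda>A. card (A \<inter> U i) = 1)" for i
    using pred_card_eq[of "\<lambda>A. A" config_space "U i" 1] U(1,2) by (simp add: pred_def)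
  have pt_in: "pt i A \<in> A \<inter> U i \<and> A \<inter> U i = {pt i A}" if "card (A \<inter> U i) = 1" for i A
  proof -
    have "\<exists>x. A \<inter> U i = {x}" using that unfolding One_nat_def card_1_singleton_iff .
    then obtain x where x: "A \<inter> U i = {x}" ..
    then have "pt i A = x" by (simp add: pt_def)
    then show ?thesis by (simp add: x del: Int_iff)
  qed
  have pt_meas [measurable]: "pt i \<in> measurable config_space borel" for i
  proof (rule measurableI)
    fix S :: "'a set" assume S: "S \<in> sets borel"
    \<comment> \<open>If \<open>U i\<close> holds a single point, that point lies in
      \<open>S\<close> exactly when \<open>U i \<inter> S\<close> also holds one point. Thus the
      preimage is expressed by counting events alone.\<close>
    have "pt i A \<in> S \<longleftrightarrow> card (A \<inter> U i) = 1 \<and> card (A \<inter> (U i \<inter> S)) = 1 \<or>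
        card (A \<inter> U i) \<noteq> 1 \<and> undefined \<in> S" for A
    proof (cases "card (A \<inter> U i) = 1")
      case True
      have "A \<inter> (U i \<inter> S) = {pt i A} \<inter> S" using pt_in[OF True] by blast
      then show ?thesis using True by (cases "pt i A \<in> S") auto
    qed (auto simp: pt_def)
    then have eq: "pt i -` S \<inter> space config_space =
      ({A\<in>space config_space. card (A \<inter> U i) = 1} \<inter> {A\<in>space config_space. card (A \<inter> (U i \<inter> S)) = 1}) \<union>
      ((space config_space - {A\<in>space config_space. card (A \<inter> U i) = 1}) \<inter>
       (if undefined \<in> S then space config_space else {}))"
      by auto
    have 1: "U i \<in> sets borel" "U i \<inter> S \<in> sets borel" "bounded (U i \<inter> S)"
      using U S by (auto intro: bounded_subset[of "U i"])
    have 2: "{A\<in>space config_space. card (A \<inter> B) = 1} \<in> sets config_space"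
      if "B \<in> sets borel" "bounded B" for B :: "'a set"
      by (rule pred_card_eq[OF _ that]) simp
    show "pt i -` S \<inter> space config_space \<in> sets config_space"
      unfolding eq by (intro sets.Un sets.Int sets.Diff 2 1 U(2)) auto
  qed simp
  have "Measurable.pred config_space (sel i)" for i
    unfolding sel_def[abs_def] by measurable
  moreover have "bij_betw (\<lambda>i. pt i A) {i. sel i A} A" if A: "locally_finite A" for A
  proof (rule bij_betw_imageI)
    show "inj_on (\<lambda>i. pt i A) {i. sel i A}"
    proof (rule inj_onI)
      fix i j assume "i \<in> {i. sel i A}" "j \<in> {i. sel i A}" "pt i A = pt j A"
      then show "i = j" by (cases i j rule: linorder_cases) (auto simp: sel_def)
    qed
    show "(\<lambda>i. pt i A) ` {i. sel i A} = A"
    proof safe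
      fix i assume "sel i A" then show "pt i A \<in> A" using pt_in by (auto simp: sel_def)
    next
      fix x assume x: "x \<in> A"
      \<comment> \<open>Only finitely many points lie within distance 1 of \<open>x\<close>, so they
        keep a positive distance \<open>e\<close> from it. A basic set around \<open>x\<close>
        inside the ball of radius \<open>min e 1\<close> then isolates \<open>x\<close>.\<close>
      define F where "F = A \<inter> ball x 1 - {x}"
      have "finite F" using A by (auto simp: F_def locally_finite_def)
      then obtain e where e: "0 < e" "\<forall>y\<in>F. y \<noteq> x \<longrightarrow> e \<le> dist x y"
        using finite_set_avoid[of F x] by auto
      obtain i where i: "x \<in> U i" "U i \<subseteq> ball x (min e 1)"
        using U(3)[of "min e 1" x] e by auto
      have "y = x" if "y \<in> A" "y \<in> U i" for y
      proof (rule ccontr)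
        assume "y \<noteq> x"
        have "dist x y < min e 1" using i(2) that(2) by auto
        with \<open>y \<noteq> x\<close> have "y \<in> F" using that(1) by (simp add: F_def)
        then have "e \<le> dist x y" using e(2) \<open>y \<noteq> x\<close> by blast
        with \<open>dist x y < min e 1\<close> show False by simp
      qed
      then have "A \<inter> U i = {x}" using i(1) x by blast
      then have ex: "card (A \<inter> U i) = 1 \<and> pt i A = x" by (simp add: pt_def)
      define m where "m = (LEAST i. card (A \<inter> U i) = 1 \<and> pt i A = x)"
      have m: "card (A \<inter> U m) = 1 \<and> pt m A = x"
        unfolding m_def using ex by (rule LeastI)
      moreover have "\<not> (card (A \<inter> U j) = 1 \<and> pt j A = x)" if "j < m" for j
        using that not_less_Least unfolding m_def by blast
      ultimately have "sel m A" by (auto simp: sel_def)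
      then show "x \<in> (\<lambda>i. pt i A) ` {i. sel i A}" using m by auto
    qed
  qed
  ultimately show ?thesis using pt_meas that by blast
qed

text \<open>By the enumeration the sum is a series over fixed indices whose terms are measurable in
  \<open>z\<close>. Both the random set and the summand may depend on \<open>z\<close>.\<close>

lemma measurable_sum_points:
  fixes A :: "'b \<Rightarrow> 'a::{metric_space, second_countable_topology} set" and f :: "'a \<times> 'b \<Rightarrow> ennreal"
  assumes A [measurable]: "A \<in> measurable N config_space"
    and f [measurable]: "f \<in> borel_measurable (borel \<Otimes>\<^sub>M N)"
  shows "(\<lambda>z. \<integral>\<^sup>+x. f (x, z) \<partial>count_space (A z)) \<in> borel_measurable N"
proof -
  obtain pt :: "nat \<Rightarrow> 'a set \<Rightarrow> 'a" and sel where
    [measurable]: "\<And>i. pt i \<in> measurable config_space borel" "\<And>i. Measurable.pred config_space (sel i)"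
    and bij: "\<And>A. locally_finite A \<Longrightarrow> bij_betw (\<lambda>i. pt i A) {i. sel i A} A"
    using measurable_enumeration by blast
  have "(\<integral>\<^sup>+x. f (x, z) \<partial>count_space (A z)) =
      (\<Sum>i. f (pt i (A z), z) * (if sel i (A z) then 1 else 0))" if "z \<in> space N" for z
  proof -
    have "locally_finite (A z)" using measurable_space[OF A that] by (simp add: space_config_space)
    then have "(\<integral>\<^sup>+x. f (x, z) \<partial>count_space (A z)) =
        (\<integral>\<^sup>+i. f (pt i (A z), z) \<partial>count_space {i. sel i (A z)})"
      by (rule nn_integral_bij_count_space[OF bij, symmetric])
    also have "\<dots> = (\<integral>\<^sup>+i. f (pt i (A z), z) * (if sel i (A z) then 1 else 0) \<partial>count_space UNIV)"
      by (subst nn_integral_count_space_indicator) (auto intro!: nn_integral_cong simp: indicator_def)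
    finally show ?thesis by (simp add: nn_integral_count_space_nat)
  qed
  then show ?thesis
    by (simp cong: measurable_cong)
qed

text \<open>A point with the property exists exactly when the sum of the indicator over the points
  is nonzero, and that sum is measurable.\<close>

lemma pred_ex_point:
  fixes A :: "'b \<Rightarrow> 'a::{metric_space, second_countable_topology} set"
  assumes A [measurable]: "A \<in> measurable N config_space"
    and P [measurable]: "Measurable.pred (borel \<Otimes>\<^sub>M N) P"
  shows "Measurable.pred N (\<lambda>z. \<exists>x\<in>A z. P (x, z))"
proof -
  have "(\<exists>x\<in>A z. P (x, z)) \<longleftrightarrow> (\<integral>\<^sup>+x. (if P (x, z) then 1 else 0) \<partial>count_space (A z)) \<noteq> 0" for z
    by (auto simp: nn_integral_0_iff_AE AE_count_space)
  moreover have "(\<lambda>z. \<integral>\<^sup>+x. (if P (x, z) then 1 else 0) \<partial>count_space (A z)) \<in> borel_measurable N"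
    using measurable_sum_points[OF A, of "\<lambda>p. if P p then 1 else 0"] by simp
  ultimately show ?thesis by simp
qed


text \<open>Two exchanges: first the sum over the countable set \<open>X w\<close> with the
  \<open>N\<close>-integral for fixed \<open>w\<close>, then Tonelli for \<open>N\<close> and
  \<open>M\<close>, with joint measurability supplied by
  \<open>measurable_sum_points\<close>.\<close>

lemma nn_integral_sum_points_swap:
  fixes X :: "'w \<Rightarrow> 'a::{metric_space, second_countable_topology} set"
    and F :: "'a \<times> 'b \<times> 'w \<Rightarrow> ennreal"
  assumes "sigma_finite_measure M" "sigma_finite_measure N"
    and X [measurable]: "X \<in> measurable M config_space"
    and F [measurable]: "F \<in> borel_measurable (borel \<Otimes>\<^sub>M (N \<Otimes>\<^sub>M M))"
  shows "(\<integral>\<^sup>+w. \<integral>\<^sup>+x. \<integral>\<^sup>+y. F (x, y, w) \<partial>N \<partial>count_space (X w) \<partial>M) =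
    (\<integral>\<^sup>+y. \<integral>\<^sup>+w. \<integral>\<^sup>+x. F (x, y, w) \<partial>count_space (X w) \<partial>M \<partial>N)"
proof -
  interpret pair_sigma_finite N M
    using assms by (simp add: pair_sigma_finite_def)
  have "(\<integral>\<^sup>+w. \<integral>\<^sup>+x. \<integral>\<^sup>+y. F (x, y, w) \<partial>N \<partial>count_space (X w) \<partial>M) =
      (\<integral>\<^sup>+w. \<integral>\<^sup>+y. \<integral>\<^sup>+x. F (x, y, w) \<partial>count_space (X w) \<partial>N \<partial>M)"
  proof (rule nn_integral_cong)
    fix w assume w [measurable]: "w \<in> space M"
    have "countable (X w)"
      using measurable_space[OF X w] by (simp add: space_config_space countable_locally_finite)
    then show "(\<integral>\<^sup>+x. \<integral>\<^sup>+y. F (x, y, w) \<partial>N \<partial>count_space (X w)) =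
        (\<integral>\<^sup>+y. \<integral>\<^sup>+x. F (x, y, w) \<partial>count_space (X w) \<partial>N)"
      by (intro nn_integral_count_space_nn_integral[symmetric]) measurable
  qed
  also have "\<dots> = (\<integral>\<^sup>+y. \<integral>\<^sup>+w. \<integral>\<^sup>+x. F (x, y, w) \<partial>count_space (X w) \<partial>M \<partial>N)"
  proof (rule Fubini')
    have "(\<lambda>z. \<integral>\<^sup>+x. F (x, z) \<partial>count_space (X (snd z))) \<in> borel_measurable (N \<Otimes>\<^sub>M M)"
      by (rule measurable_sum_points) measurable
    then show "(\<lambda>(y, w). \<integral>\<^sup>+x. F (x, y, w) \<partial>count_space (X w)) \<in> borel_measurable (N \<Otimes>\<^sub>M M)"
      by (simp add: case_prod_beta')
  qed
  finally show ?thesis .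
qed

lemma nn_integral_if_count_space:
  "(\<integral>\<^sup>+x. (if P x then 1 else 0) \<partial>count_space A) = num_points {x\<in>A. P x}"
proof -
  have "(\<integral>\<^sup>+x. (if P x then 1 else 0) \<partial>count_space A) =
      (\<integral>\<^sup>+x. indicator {x\<in>A. P x} x \<partial>count_space A)"
    by (intro nn_integral_cong) auto
  also have "\<dots> = num_points {x\<in>A. P x}"
    by (subst nn_integral_indicator) (auto simp: num_points_def emeasure_count_space)
  finally show ?thesis .
qed

section \<open>Translations\<close>

lemma translate_Int: "(+) v ` A \<inter> B = (+) v ` (A \<inter> (+) v -` B)"
  for v :: "'a::group_add"
  by auto

lemma card_translate_Int: "card ((+) v ` A \<inter> B) = card (A \<inter> (+) v -` B)"
  for v :: "'a::group_add"
  unfolding translate_Int by (rule card_image) simp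

lemma bounded_vimage_translate:
  fixes v :: "'a::real_normed_vector"
  assumes "bounded B"
  shows "bounded ((+) v -` B)"
proof -
  have "(+) v -` B = (+) (- v) ` B" by (force simp: image_iff algebra_simps)
  then show ?thesis using bounded_translation[OF assms, of "- v"] by simp
qed

lemma sets_vimage_translate: "B \<in> sets borel \<Longrightarrow> (+) v -` B \<in> sets borel"
  for v :: "'a::{real_normed_vector, second_countable_topology}"
  using measurable_sets[of "(+) v" borel borel B] by simp

lemma emeasure_lborel_vimage_translate:
  fixes v :: "'a::euclidean_space"
  assumes "B \<in> sets borel"
  shows "emeasure lborel ((+) v -` B) = emeasure lborel B"
proof -
  have "emeasure (distr lborel borel ((+) v)) B = emeasure lborel ((+) v -` B)"
    using assms by (subst emeasure_distr) auto
  then show ?thesis by (simp add: lborel_distr_plus)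
qed

lemma measurable_translate:
  fixes X :: "'w \<Rightarrow> 'a::{real_normed_vector, second_countable_topology} set"
  assumes X: "X \<in> measurable M config_space"
  shows "(\<lambda>w. (+) v ` X w) \<in> measurable M config_space"
  unfolding measurable_config_space_iff
proof safe
  fix w assume "w \<in> space M"
  then have "locally_finite (X w)" using X by (simp add: measurable_config_space_iff)
  then show "locally_finite ((+) v ` X w)"
    unfolding locally_finite_def translate_Int by (simp add: bounded_vimage_translate)
next
  fix B :: "'a set" and k assume "B \<in> sets borel" "bounded B"
  then show "{w \<in> space M. card ((+) v ` X w \<inter> B) = k} \<in> sets M"
    unfolding card_translate_Int
    by (intro pred_card_eq X sets_vimage_translate bounded_vimage_translate)
qed

lemma sum_points_translate:
  fixes v :: "'a::group_add"
  shows "(\<integral>\<^sup>+x. f x \<partial>count_space ((+) v ` A)) = (\<integral>\<^sup>+x. f (v + x) \<partial>count_space A)"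
  by (rule nn_integral_bij_count_space[symmetric]) (simp add: bij_betw_def)

text \<open>A single change of variables that serves for translations (\<open>c = 1\<close>), the
  reflection (\<open>c = -1\<close>) and the dilation by \<open>r\<close>.\<close>

lemma nn_integral_lborel_affine:
  fixes f :: "'a::euclidean_space \<Rightarrow> ennreal"
  assumes [measurable]: "f \<in> borel_measurable borel" and "c \<noteq> 0"
  shows "(\<integral>\<^sup>+x. f x \<partial>lborel) = ennreal (\<bar>c\<bar> ^ DIM('a)) * (\<integral>\<^sup>+x. f (t + c *\<^sub>R x) \<partial>lborel)"
  by (subst lborel_affine[OF \<open>c \<noteq> 0\<close>, of t])
     (simp add: nn_integral_density nn_integral_distr nn_integral_cmult)

text \<open>The free corner \<open>a\<close> covers both the cube in \<open>intensity\<close> and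
  the centred cube in \<open>Theta\<close>.\<close>

lemma emeasure_lborel_unit_cube:
  assumes "b = a + 1"
  shows "emeasure lborel (cbox (\<chi> i. a) (\<chi> i. b) :: (real ^ 'n) set) = 1"
proof -
  have "(\<chi> i. c) \<bullet> e = c" if "e \<in> Basis" for e :: "real ^ 'n" and c
    using that by (auto simp: Basis_vec_def inner_axis)
  then show ?thesis using assms by (simp add: emeasure_lborel_cbox_eq inner_diff_left)
qed

section \<open>Integrals over stationary processes and Campbell's formula\<close>

lemma stationary_nn_integral:
  assumes "stationary M X" and X [measurable]: "X \<in> measurable M config_space"
    and g [measurable]: "g \<in> borel_measurable config_space"
  shows "(\<integral>\<^sup>+w. g ((+) v ` X w) \<partial>M) = (\<integral>\<^sup>+w. g (X w) \<partial>M)"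
proof -
  have [measurable]: "(\<lambda>w. (+) v ` X w) \<in> measurable M config_space"
    by (rule measurable_translate) fact
  have "(\<integral>\<^sup>+w. g ((+) v ` X w) \<partial>M) = (\<integral>\<^sup>+A. g A \<partial>distr M config_space (\<lambda>w. (+) v ` X w))"
    by (simp add: nn_integral_distr)
  also have "\<dots> = (\<integral>\<^sup>+A. g A \<partial>distr M config_space X)"
    using assms(1) by (simp add: stationary_def)
  finally show ?thesis by (simp add: nn_integral_distr)
qed

text \<open>Uniqueness of Haar measure in disguise: insert the integral of the indicator of a unit cube
  and shift the points by stationarity.\<close>

lemma campbell:
  fixes X :: "'w \<Rightarrow> (real ^ 'n) set"
  assumes M: "sigma_finite_measure M" and st: "stationary M X"
    and X [measurable]: "X \<in> measurable M config_space"
    and f [measurable]: "f \<in> borel_measurable borel"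
  shows "(\<integral>\<^sup>+w. \<integral>\<^sup>+x. f x \<partial>count_space (X w) \<partial>M) = intensity M X * (\<integral>\<^sup>+x. f x \<partial>lborel)"
proof -
  define Q :: "(real ^ 'n) set" where "Q = cbox (\<chi> i. 0) (\<chi> i. 1)"
  have [measurable]: "Q \<in> sets borel" by (simp add: Q_def)
  define q :: "real ^ 'n \<Rightarrow> ennreal" where "q x = (if x \<in> Q then 1 else 0)" for x
  have q [measurable]: "q \<in> borel_measurable borel" unfolding q_def[abs_def] by measurable
  have "q = indicator Q" by (auto simp: q_def)
  then have "(\<integral>\<^sup>+x. q x \<partial>lborel) = 1"
    using emeasure_lborel_unit_cube[of 1 0, where 'n='n] by (simp add: Q_def)
  then have q1: "(\<integral>\<^sup>+y. q (x + y) \<partial>lborel) = 1" for x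
    using nn_integral_lborel_affine[OF q, of 1 x] by simp
  have refl: "(\<integral>\<^sup>+y. f (x - y) \<partial>lborel) = (\<integral>\<^sup>+x. f x \<partial>lborel)" for x
    using nn_integral_lborel_affine[OF f, of "-1" x] by simp
  have "(\<integral>\<^sup>+w. \<integral>\<^sup>+x. f x \<partial>count_space (X w) \<partial>M) =
      (\<integral>\<^sup>+w. \<integral>\<^sup>+x. \<integral>\<^sup>+y. f x * q (x + y) \<partial>lborel \<partial>count_space (X w) \<partial>M)"
    by (simp add: nn_integral_cmult q1)
  also have "\<dots> = (\<integral>\<^sup>+y. \<integral>\<^sup>+w. \<integral>\<^sup>+x. f x * q (x + y) \<partial>count_space (X w) \<partial>M \<partial>lborel)"
    using nn_integral_sum_points_swap[OF M sigma_finite_lborel X,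
        where F = "\<lambda>(x, y, w). f x * q (x + y)"] by simp
  \<comment> \<open>Shifting the process by \<open>- y\<close> moves the dependence on
    \<open>y\<close> from \<open>q\<close> to \<open>f\<close>. After swapping back, the
    \<open>y\<close>-integral hits \<open>f\<close> alone and \<open>refl\<close> makes it
    independent of the point \<open>x\<close>.\<close>
  also have "\<dots> = (\<integral>\<^sup>+y. \<integral>\<^sup>+w. \<integral>\<^sup>+x. f (- y + x) * q x \<partial>count_space (X w) \<partial>M \<partial>lborel)"
  proof (rule nn_integral_cong)
    fix y :: "real ^ 'n"
    have "(\<lambda>A. \<integral>\<^sup>+x. f x * q (x + y) \<partial>count_space A) \<in> borel_measurable config_space"
      using measurable_sum_points[of "\<lambda>A. A" config_space "\<lambda>(x, A). f x * q (x + y)"] by simp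
    from stationary_nn_integral[OF st X this, of "- y"]
    show "(\<integral>\<^sup>+w. \<integral>\<^sup>+x. f x * q (x + y) \<partial>count_space (X w) \<partial>M) =
        (\<integral>\<^sup>+w. \<integral>\<^sup>+x. f (- y + x) * q x \<partial>count_space (X w) \<partial>M)"
      unfolding sum_points_translate by simp
  qed
  also have "\<dots> = (\<integral>\<^sup>+w. \<integral>\<^sup>+x. \<integral>\<^sup>+y. f (- y + x) * q x \<partial>lborel \<partial>count_space (X w) \<partial>M)"
    using nn_integral_sum_points_swap[OF M sigma_finite_lborel X,
        where F = "\<lambda>(x, y, w). f (- y + x) * q x"] by simp
  also have "\<dots> = (\<integral>\<^sup>+w. (\<integral>\<^sup>+x. q x \<partial>count_space (X w)) * (\<integral>\<^sup>+x. f x \<partial>lborel) \<partial>M)"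
    by (simp add: nn_integral_multc refl mult.commute nn_integral_cmult)
  also have "\<dots> = (\<integral>\<^sup>+w. \<integral>\<^sup>+x. q x \<partial>count_space (X w) \<partial>M) * (\<integral>\<^sup>+x. f x \<partial>lborel)"
    using measurable_sum_points[OF X, of "\<lambda>(x, w). q x"] by (intro nn_integral_multc) simp
  also have "(\<integral>\<^sup>+w. \<integral>\<^sup>+x. q x \<partial>count_space (X w) \<partial>M) = intensity M X"
    by (simp add: q_def nn_integral_if_count_space intensity_def Q_def Int_def)
  finally show ?thesis .
qed

section \<open>Stationarity of the Poisson process\<close>

text \<open>Counting the shifted points in \<open>B\<close> amounts to counting the original points
  in the preimage of \<open>B\<close>. Preimages under a translation keep Lebesgue measure,
  boundedness and disjointness, so each defining clause carries over.\<close>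

lemma poisson_process_translate:
  fixes X :: "'w \<Rightarrow> (real ^ 'n) set"
  assumes "poisson_process M lam X"
  shows "poisson_process M lam (\<lambda>w. (+) v ` X w)"
  unfolding poisson_process_def
proof (intro conjI allI impI)
  show "point_process M (\<lambda>w. (+) v ` X w)"
    using assms by (simp add: poisson_process_def point_process_def measurable_translate)
next
  fix B :: "(real ^ 'n) set" and k
  assume B: "B \<in> sets borel \<and> bounded B"
  have "measure lborel ((+) v -` B) = measure lborel B"
    using B by (simp add: measure_def emeasure_lborel_vimage_translate)
  with B show "measure M {w \<in> space M. card ((+) v ` X w \<inter> B) = k} =
      (lam * measure lborel B) ^ k / fact k * exp (- (lam * measure lborel B))"
    unfolding card_translate_Int
    using assms by (simp add: poisson_process_def sets_vimage_translate bounded_vimage_translate)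
next
  fix n :: nat and B :: "nat \<Rightarrow> (real ^ 'n) set"
  assume "(\<forall>i<n. B i \<in> sets borel \<and> bounded (B i)) \<and> disjoint_family_on B {..<n}"
  moreover from this have "disjoint_family_on (\<lambda>i. (+) v -` B i) {..<n}"
    by (auto simp: disjoint_family_on_def)
  ultimately show "prob_space.indep_vars M (\<lambda>_. count_space UNIV)
      (\<lambda>i w. card ((+) v ` X w \<inter> B i)) {..<n}"
    unfolding card_translate_Int
    using assms by (simp add: poisson_process_def sets_vimage_translate bounded_vimage_translate)
qed

section \<open>Uniqueness of the law of a Poisson process\<close>

lemma poisson_process_emeasure_card:
  fixes X :: "'w \<Rightarrow> (real ^ 'n) set"
  assumes X: "poisson_process M lam X" and B: "B \<in> sets borel" "bounded B"
  shows "emeasure (distr M (count_space UNIV) (\<lambda>w. card (X w \<inter> B))) {k} =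
    ennreal ((lam * measure lborel B) ^ k / fact k * exp (- (lam * measure lborel B)))"
proof -
  interpret prob_space M using X by (simp add: poisson_process_def point_process_def)
  have "X \<in> measurable M config_space"
    using X by (simp add: poisson_process_def point_process_def)
  from measurable_card[OF this B]
  have "emeasure (distr M (count_space UNIV) (\<lambda>w. card (X w \<inter> B))) {k} =
      emeasure M {w \<in> space M. card (X w \<inter> B) = k}"
    by (subst emeasure_distr) (auto intro!: arg_cong2[where f = emeasure])
  then show ?thesis
    using X B by (simp add: poisson_process_def emeasure_eq_measure)
qed

lemma poisson_process_distr_card:
  fixes X :: "'w \<Rightarrow> (real ^ 'n) set" and X' :: "'v \<Rightarrow> (real ^ 'n) set"
  assumes "poisson_process M lam X" "poisson_process M' lam X'" "B \<in> sets borel" "bounded B"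
  shows "distr M (count_space UNIV) (\<lambda>w. card (X w \<inter> B)) =
    distr M' (count_space UNIV) (\<lambda>w. card (X' w \<inter> B))"
  by (rule measure_eqI_countable[where A = UNIV])
     (simp_all add: poisson_process_emeasure_card[OF assms(1,3,4)] poisson_process_emeasure_card[OF assms(2-4)])

text \<open>Independence is postulated for disjoint sets only, so overlapping sets are cut into the
  atoms they generate. An atom collects the points with a prescribed set of indices \<open>i\<close>
  such that the point lies in \<open>B i\<close>.\<close>

lemma disjoint_refinement:
  fixes B :: "nat \<Rightarrow> 'a::metric_space set"
  assumes B: "\<And>i. B i \<in> sets borel" "\<And>i. bounded (B i)"
  obtains N :: nat and C :: "nat \<Rightarrow> 'a set" and J :: "nat \<Rightarrow> nat set"
  where "0 < N" "\<And>m. C m \<in> sets borel" "\<And>m. bounded (C m)" "disjoint_family_on C {..<N}"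
    "\<And>i A. i < n \<Longrightarrow> locally_finite A \<Longrightarrow> card (A \<inter> B i) = (\<Sum>m\<in>J i. card (A \<inter> C m))"
    "\<And>i. J i \<subseteq> {..<N}"
proof -
  define N where "N = card (Pow {..<n})"
  obtain h where h: "bij_betw h {0..<N} (Pow {..<n})"
    using ex_bij_betw_nat_finite[of "Pow {..<n}"] by (auto simp: N_def)
  \<comment> \<open>The bijection \<open>h\<close> numbers the membership patterns. The first
    conjunct removes the unbounded region outside all \<open>B i\<close>, so the empty pattern
    yields the empty set.\<close>
  define C where "C m = {x. (\<exists>i<n. x \<in> B i) \<and> (\<forall>i<n. x \<in> B i \<longleftrightarrow> i \<in> h m)}" for m
  define J where "J i = {m. m < N \<and> i \<in> h m}" for i
  \<comment> \<open>The empty pattern is counted, so \<open>N\<close> is positive even for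
    \<open>n = 0\<close>. The index set \<open>{..<N}\<close> is then nonempty, as required when
    independence is rewritten as a product law.\<close>
  have "0 < N" by (simp add: N_def card_Pow)
  moreover have "C m \<in> sets borel" for m
  proof -
    have [measurable]: "Measurable.pred borel (\<lambda>x. x \<in> B i)" for i using B(1) by measurable
    have "{x \<in> space borel. (\<exists>i<n. x \<in> B i) \<and> (\<forall>i<n. x \<in> B i \<longleftrightarrow> i \<in> h m)} \<in> sets borel"
      by measurable
    then show ?thesis by (simp add: C_def)
  qed
  moreover have Cb: "bounded (C m)" for m
  proof (rule bounded_subset)
    show "bounded (\<Union>i<n. B i)" using B(2) by (intro bounded_UN) auto
  qed (auto simp: C_def)
  moreover have disj: "C m \<inter> C m' = {}" if "m < N" "m' < N" "m \<noteq> m'" for m m'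
  proof -
    have "h m \<noteq> h m'" "h m \<subseteq> {..<n}" "h m' \<subseteq> {..<n}"
      using that h by (auto simp: bij_betw_def dest: inj_onD)
    then show ?thesis by (auto simp: C_def)
  qed
  moreover have "card (A \<inter> B i) = (\<Sum>m\<in>J i. card (A \<inter> C m))"
    if i: "i < n" and A: "locally_finite A" for i A
  proof -
    have "A \<inter> B i = (\<Union>m\<in>J i. A \<inter> C m)"
    proof safe
      fix x assume x: "x \<in> A" "x \<in> B i"
      have "{j. j < n \<and> x \<in> B j} \<in> h ` {0..<N}" using h by (auto simp: bij_betw_def)
      then obtain m where "m < N" "{j. j < n \<and> x \<in> B j} = h m" by auto
      with x i show "x \<in> (\<Union>m\<in>J i. A \<inter> C m)" by (auto simp: C_def J_def)
    qed (use i in \<open>auto simp: C_def J_def\<close>)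
    also have "card \<dots> = (\<Sum>m\<in>J i. card (A \<inter> C m))"
    proof (rule card_UN_disjoint)
      show "\<forall>m\<in>J i. finite (A \<inter> C m)" using A Cb by (simp add: locally_finite_def)
      show "\<forall>m\<in>J i. \<forall>m'\<in>J i. m \<noteq> m' \<longrightarrow> A \<inter> C m \<inter> (A \<inter> C m') = {}"
        using disj by (auto simp: J_def)
    qed (simp add: J_def)
    finally show ?thesis .
  qed
  ultimately show ?thesis
    by (intro that[of N C J]) (auto simp: disjoint_family_on_def J_def)
qed

text \<open>For disjoint sets, independence says that the joint law of the counts is the product of
  the marginal laws.\<close>

lemma poisson_process_emeasure_cards:
  fixes X :: "'w \<Rightarrow> (real ^ 'n) set" and N :: nat
  assumes X: "poisson_process M lam X" and N: "0 < N"
    and C: "\<And>m. C m \<in> sets borel" "\<And>m. bounded (C m)" "disjoint_family_on C {..<N}"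
    and T: "T \<subseteq> (\<Pi>\<^sub>E m\<in>{..<N}. UNIV)"
  shows "emeasure M {w \<in> space M. (\<lambda>m\<in>{..<N}. card (X w \<inter> C m)) \<in> T} =
    emeasure (\<Pi>\<^sub>M m\<in>{..<N}. distr M (count_space UNIV) (\<lambda>w. card (X w \<inter> C m))) T"
proof -
  interpret prob_space M using X by (simp add: poisson_process_def point_process_def)
  have Xm: "X \<in> measurable M config_space"
    using X by (simp add: poisson_process_def point_process_def)
  let ?P = "\<Pi>\<^sub>M m\<in>{..<N}. count_space (UNIV :: nat set)"
  let ?V = "\<lambda>w. \<lambda>m\<in>{..<N}. card (X w \<inter> C m)"
  have rv: "(\<lambda>w. card (X w \<inter> C m)) \<in> measurable M (count_space UNIV)" for m
    by (rule measurable_card[OF Xm C(1,2)])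
  have "indep_vars (\<lambda>_. count_space UNIV) (\<lambda>m w. card (X w \<inter> C m)) {..<N}"
    using X C by (simp add: poisson_process_def)
  then have eq: "distr M ?P ?V =
      (\<Pi>\<^sub>M m\<in>{..<N}. distr M (count_space UNIV) (\<lambda>w. card (X w \<inter> C m)))"
    using N rv by (subst (asm) indep_vars_iff_distr_eq_PiM) auto
  \<comment> \<open>A finite product of countable discrete spaces is discrete, so every set
    \<open>T\<close> of count vectors is an event.\<close>
  have "?P = count_space (\<Pi>\<^sub>E m\<in>{..<N}. UNIV)"
    by (rule count_space_PiM_finite) auto
  then have "T \<in> sets ?P" using T by simp
  moreover have "?V \<in> measurable M ?P" using rv by (intro measurable_restrict)
  ultimately have "emeasure (distr M ?P ?V) T = emeasure M {w \<in> space M. ?V w \<in> T}"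
    by (simp add: emeasure_distr vimage_def Int_def conj_commute)
  then show ?thesis by (simp add: eq)
qed

text \<open>On the atoms of the refinement the event depends only on the vector of counts, whose law
  is a product of Poisson laws fixed by \<open>lam\<close>. Hence both processes give it the same
  probability.\<close>

lemma poisson_process_cards_unique:
  fixes X :: "'w \<Rightarrow> (real ^ 'n) set" and X' :: "'v \<Rightarrow> (real ^ 'n) set" and n :: nat
  assumes X: "poisson_process M lam X" and X': "poisson_process M' lam X'"
    and B: "\<And>i. B i \<in> sets borel" "\<And>i. bounded (B i)"
  shows "emeasure M {w \<in> space M. \<forall>i<n. card (X w \<inter> B i) = k i} =
    emeasure M' {w \<in> space M'. \<forall>i<n. card (X' w \<inter> B i) = k i}"
proof -
  obtain N :: nat and C J where N: "0 < N"
    and C: "\<And>m. C m \<in> sets borel" "\<And>m. bounded (C m)" "disjoint_family_on C {..<N}"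
    and card: "\<And>i A. i < n \<Longrightarrow> locally_finite A \<Longrightarrow> card (A \<inter> B i) = (\<Sum>m\<in>J i. card (A \<inter> C m))"
    and J: "\<And>i. J i \<subseteq> {..<N}"
    by (rule disjoint_refinement[OF B, where n = n]) (rule that)
  \<comment> \<open>The vectors of atom counts for which every \<open>B i\<close> receives
    \<open>k i\<close> points in total.\<close>
  define T where "T = {v \<in> (\<Pi>\<^sub>E m\<in>{..<N}. UNIV). \<forall>i<n. (\<Sum>m\<in>J i. v m) = k i}"
  have T: "T \<subseteq> (\<Pi>\<^sub>E m\<in>{..<N}. UNIV)" by (auto simp: T_def)
  have iff: "(\<forall>i<n. card (A \<inter> B i) = k i) \<longleftrightarrow> (\<lambda>m\<in>{..<N}. card (A \<inter> C m)) \<in> T"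
    if "locally_finite A" for A
  proof -
    have "(\<Sum>m\<in>J i. (\<lambda>m\<in>{..<N}. card (A \<inter> C m)) m) = (\<Sum>m\<in>J i. card (A \<inter> C m))" for i
      using J by (intro sum.cong) auto
    then show ?thesis using that by (auto simp: T_def card)
  qed
  have lf: "w \<in> space M \<Longrightarrow> locally_finite (X w)" "w' \<in> space M' \<Longrightarrow> locally_finite (X' w')" for w w'
    using X X' by (simp_all add: poisson_process_def point_process_def measurable_config_space_iff)
  have "distr M (count_space UNIV) (\<lambda>w. card (X w \<inter> C m)) =
      distr M' (count_space UNIV) (\<lambda>w. card (X' w \<inter> C m))" for m
    by (rule poisson_process_distr_card[OF X X' C(1,2)])
  then show ?thesis
    using poisson_process_emeasure_cards[OF X N C T] poisson_process_emeasure_cards[OF X' N C T]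
    by (simp add: iff lf cong: conj_cong)
qed

text \<open>Two finite measures that agree on an intersection-stable generator agree; the generator
  consists of the finite conjunctions of counting events.\<close>

lemma poisson_process_law_unique:
  fixes X :: "'w \<Rightarrow> (real ^ 'n) set" and X' :: "'v \<Rightarrow> (real ^ 'n) set"
  assumes X: "poisson_process M lam X" and X': "poisson_process M' lam X'"
  shows "distr M config_space X = distr M' config_space X'"
proof -
  have Xm: "X \<in> measurable M config_space" and X'm: "X' \<in> measurable M' config_space"
    using assms by (simp_all add: poisson_process_def point_process_def)
  let ?\<Omega> = "{A :: (real ^ 'n) set. locally_finite A}"
  let ?G = "{{A :: (real ^ 'n) set. locally_finite A \<and> card (A \<inter> B) = k} | B k.
    B \<in> sets borel \<and> bounded B}"
  \<comment> \<open>The intersection of two single counting events need not be one, hence events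
    with \<open>n\<close> simultaneous counts.\<close>
  define ev where "ev n B k = {A. locally_finite A \<and> (\<forall>i<n. card (A \<inter> B i) = k i)}"
    for n :: nat and B :: "nat \<Rightarrow> (real ^ 'n) set" and k
  define E where "E = {ev n B k | n B k. \<forall>i. B i \<in> sets borel \<and> bounded (B i)}"
  have ev_sets: "ev n B k \<in> sets config_space" if "\<forall>i. B i \<in> sets borel \<and> bounded (B i)" for n B k
  proof -
    have "{A \<in> space config_space. \<forall>i\<in>{..<n}. card (A \<inter> B i) = k i} \<in> sets config_space"
      using that by (intro sets.sets_Collect_finite_All pred_card_eq) auto
    then show ?thesis by (simp add: ev_def space_config_space Ball_def)
  qed
  have "sets config_space = sigma_sets ?\<Omega> ?G"
    unfolding config_space_def by (rule sets_measure_of) auto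
  also have "\<dots> = sigma_sets ?\<Omega> E"
  proof (rule sigma_sets_eqI)
    fix a assume "a \<in> ?G"
    then obtain B k where "a = ev 1 (\<lambda>_. B) (\<lambda>_. k)" "B \<in> sets borel" "bounded B"
      by (auto simp: ev_def)
    then show "a \<in> sigma_sets ?\<Omega> E" by (intro sigma_sets.Basic) (auto simp: E_def)
  next
    fix b assume "b \<in> E"
    then have "b \<in> sets config_space" using ev_sets by (auto simp: E_def)
    then show "b \<in> sigma_sets ?\<Omega> ?G" by (simp add: calculation)
  qed
  finally have sets: "sets config_space = sigma_sets ?\<Omega> E" .
  show ?thesis
  proof (rule measure_eqI_generator_eq[where E = E and \<Omega> = ?\<Omega> and A = "\<lambda>_. ?\<Omega>"])
    show "Int_stable E"
    proof (rule Int_stableI)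
      fix a b assume "a \<in> E" "b \<in> E"
      then obtain n B k n' B' k' where
        a: "a = ev n B k" "\<forall>i. B i \<in> sets borel \<and> bounded (B i)" and
        b: "b = ev n' B' k'" "\<forall>i. B' i \<in> sets borel \<and> bounded (B' i)"
        by (auto simp: E_def)
      \<comment> \<open>The two families of constraints are placed one after the other, the second
        shifted by \<open>n\<close>.\<close>
      define B'' where "B'' i = (if i < n then B i else B' (i - n))" for i
      define k'' where "k'' i = (if i < n then k i else k' (i - n))" for i
      have "(\<forall>i<n + n'. card (A \<inter> B'' i) = k'' i) \<longleftrightarrow>
          (\<forall>i<n. card (A \<inter> B i) = k i) \<and> (\<forall>i<n'. card (A \<inter> B' i) = k' i)" (is "?l \<longleftrightarrow> ?r") for A
      proof
        assume l: ?l
        have "card (A \<inter> B i) = k i" if "i < n" for i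
          using l[rule_format, of i] that by (simp add: B''_def k''_def)
        moreover have "card (A \<inter> B' i) = k' i" if "i < n'" for i
          using l[rule_format, of "n + i"] that by (simp add: B''_def k''_def)
        ultimately show ?r by simp
      qed (auto simp: B''_def k''_def)
      then have "a \<inter> b = ev (n + n') B'' k''" by (auto simp: a b ev_def)
      moreover have "\<forall>i. B'' i \<in> sets borel \<and> bounded (B'' i)" using a b by (simp add: B''_def)
      ultimately show "a \<inter> b \<in> E" by (auto simp: E_def)
    qed
    show "E \<subseteq> Pow ?\<Omega>" by (auto simp: E_def ev_def)
    \<comment> \<open>With \<open>n = 0\<close> there is no constraint, so the whole space belongs
      to \<open>E\<close>.\<close>
    show "range (\<lambda>_::nat. ?\<Omega>) \<subseteq> E"
      by (auto simp: E_def ev_def intro!: exI[of _ "0::nat"] exI[of _ "\<lambda>_. {}"])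
    fix a assume "a \<in> E"
    then obtain n B k where a: "a = ev n B k" and B: "\<And>i. B i \<in> sets borel" "\<And>i. bounded (B i)"
      by (auto simp: E_def)
    have "emeasure (distr M config_space X) a =
        emeasure M {w \<in> space M. \<forall>i<n. card (X w \<inter> B i) = k i}"
      using Xm ev_sets[of B n k] B measurable_space[OF Xm]
      by (auto simp: a emeasure_distr ev_def space_config_space intro!: arg_cong2[where f = emeasure])
    also have "\<dots> = emeasure M' {w \<in> space M'. \<forall>i<n. card (X' w \<inter> B i) = k i}"
      by (rule poisson_process_cards_unique[OF X X' B])
    also have "\<dots> = emeasure (distr M' config_space X') a"
      using X'm ev_sets[of B n k] B measurable_space[OF X'm]
      by (auto simp: a emeasure_distr ev_def space_config_space intro!: arg_cong2[where f = emeasure])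
    finally show "emeasure (distr M config_space X) a = emeasure (distr M' config_space X') a" .
  next
    interpret prob_space M using X by (simp add: poisson_process_def point_process_def)
    interpret D: prob_space "distr M config_space X" by (rule prob_space_distr) fact
    show "emeasure (distr M config_space X) ?\<Omega> \<noteq> \<infinity>" by simp
  qed (simp_all add: sets)
qed

text \<open>The translated process is again Poisson with the same \<open>lam\<close>, so uniqueness
  identifies the two laws.\<close>

lemma poisson_process_stationary:
  assumes "poisson_process M lam X"
  shows "stationary M X"
  unfolding stationary_def
  using poisson_process_law_unique[OF poisson_process_translate[OF assms] assms] by blast

section \<open>Connectability\<close>

lemma k_connectable_1: "k_connectable A (Suc 0) x y \<longleftrightarrow> norm (x - y) \<le> 1"
proof
  assume "norm (x - y) \<le> 1"
  then show "k_connectable A (Suc 0) x y"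
    unfolding k_connectable_def by (intro conjI exI[of _ "case_nat x (\<lambda>_. y)"]) auto
qed (auto simp: k_connectable_def)

text \<open>Splitting off the first hop replaces the quantifier over whole paths by one over a point
  of \<open>A\<close>. For \<open>k \<ge> 1\<close> the vertex after the first hop is an inner
  vertex and so lies in \<open>A\<close>.\<close>

lemma k_connectable_Suc:
  assumes "k \<ge> 1"
  shows "k_connectable A (Suc k) x y \<longleftrightarrow> (\<exists>z\<in>A. norm (x - z) \<le> 1 \<and> k_connectable A k z y)"
proof
  assume "k_connectable A (Suc k) x y"
  then obtain z where z: "z 0 = x" "z (Suc k) = y" "\<forall>j\<in>{1..<Suc k}. z j \<in> A"
      "\<forall>j<Suc k. norm (z j - z (Suc j)) \<le> 1"
    by (auto simp: k_connectable_def)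
  have "k_connectable A k (z 1) y"
    unfolding k_connectable_def using z assms by (intro conjI exI[of _ "\<lambda>j. z (Suc j)"]) auto
  moreover have "z 1 \<in> A" "norm (x - z 1) \<le> 1" using z assms by auto
  ultimately show "\<exists>z\<in>A. norm (x - z) \<le> 1 \<and> k_connectable A k z y" by blast
next
  assume "\<exists>z\<in>A. norm (x - z) \<le> 1 \<and> k_connectable A k z y"
  then obtain z where "z 0 \<in> A" "norm (x - z 0) \<le> 1" "z k = y" "\<forall>j\<in>{1..<k}. z j \<in> A"
      "\<forall>j<k. norm (z j - z (Suc j)) \<le> 1"
    by (auto simp: k_connectable_def)
  moreover from this have "\<forall>j<k. z j \<in> A" by (metis Suc_leI atLeastLessThan_iff gr0I One_nat_def)
  ultimately show "k_connectable A (Suc k) x y"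
    unfolding k_connectable_def
    by (intro conjI exI[of _ "case_nat x z"]) (auto split: nat.split simp: less_Suc_eq_0_disj)
qed

text \<open>Induction on the number of hops: each step adds one existential quantifier over the
  points of \<open>A\<close>, which \<open>pred_ex_point\<close> handles.\<close>

lemma pred_k_connectable:
  assumes "k \<ge> 1"
  shows "Measurable.pred (borel \<Otimes>\<^sub>M (borel \<Otimes>\<^sub>M config_space)) (\<lambda>(x :: real ^ 'n, y, A). k_connectable A k x y)"
  using assms
proof (induction k rule: dec_induct)
  case base
  show ?case by (simp add: k_connectable_1)
next
  case (step k)
  let ?N = "borel \<Otimes>\<^sub>M (borel \<Otimes>\<^sub>M config_space) :: ((real ^ 'n) \<times> (real ^ 'n) \<times> (real ^ 'n) set) measure"
  \<comment> \<open>Here \<open>p\<close> stands for \<open>(z, x, y, A)\<close>; the induction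
    hypothesis is applied to \<open>(z, y, A)\<close>.\<close>
  have "Measurable.pred (borel \<Otimes>\<^sub>M ?N)
      (\<lambda>p. case (fst p, fst (snd (snd p)), snd (snd (snd p))) of (x, y, A) \<Rightarrow> k_connectable A k x y)"
    by (rule measurable_compose[OF _ step.IH]) measurable
  then have [measurable]: "Measurable.pred (borel \<Otimes>\<^sub>M ?N)
      (\<lambda>p. k_connectable (snd (snd (snd p))) k (fst p) (fst (snd (snd p))))"
    unfolding prod.case .
  have "Measurable.pred ?N (\<lambda>p. \<exists>z\<in>snd (snd p). (\<lambda>(z, p). norm (fst p - z) \<le> 1 \<and>
      k_connectable (snd (snd p)) k z (fst (snd p))) (z, p))"
    by (rule pred_ex_point) (simp_all add: case_prod_beta')
  then show ?case using step.hyps by (simp add: k_connectable_Suc case_prod_beta')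
qed

lemma pred_connectable:
  assumes [measurable]: "f \<in> borel_measurable N" "g \<in> borel_measurable N"
    "A \<in> measurable N config_space"
  shows "Measurable.pred N (\<lambda>z. connectable (A z) (f z) (g z))"
proof -
  have "Measurable.pred N (\<lambda>z. case (f z, g z, A z) of (x, y, A) \<Rightarrow> k_connectable A k x y)"
    if "k \<ge> 1" for k
    by (rule measurable_compose[OF _ pred_k_connectable[OF that]]) measurable
  then have "Measurable.pred N (\<lambda>z. \<exists>k\<in>{1..}. k_connectable (A z) k (f z) (g z))"
    by (intro pred_intros_countable_bounded) auto
  moreover have "connectable (A z) (f z) (g z) \<longleftrightarrow> (\<exists>k\<in>{1..}. k_connectable (A z) k (f z) (g z))" for z
    by (auto simp: connectable_def)
  ultimately show ?thesis by simp
qed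

lemma k_connectable_translate_imp:
  assumes "k_connectable A k x y"
  shows "k_connectable ((+) v ` A) k (v + x) (v + y)"
proof -
  obtain z where "k \<ge> 1" "z 0 = x" "z k = y" "\<forall>j\<in>{1..<k}. z j \<in> A" "\<forall>j<k. norm (z j - z (Suc j)) \<le> 1"
    using assms by (auto simp: k_connectable_def)
  then show ?thesis
    unfolding k_connectable_def by (intro conjI exI[of _ "\<lambda>j. v + z j"]) auto
qed

lemma connectable_translate:
  "connectable ((+) v ` A) (v + x) (v + y) \<longleftrightarrow> connectable A x y"
proof -
  have "k_connectable A k x y" if "k_connectable ((+) v ` A) k (v + x) (v + y)" for k
    using k_connectable_translate_imp[OF that, of "- v"] by (simp add: image_image)
  then show ?thesis
    using k_connectable_translate_imp unfolding connectable_def by blast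
qed

text \<open>A finite bound excludes the infimum of the empty set, which is infinite, so some path
  exists. Passing to plain connectability is what makes the final bound uniform in
  \<open>k\<close>.\<close>

lemma hops_leE:
  assumes "hops A Y r x \<le> enat k"
  obtains y where "y \<in> Y" "connectable A x (r *\<^sub>R y)"
proof -
  have "{enat k | k. k \<ge> 1 \<and> (\<exists>y \<in> (\<lambda>y. r *\<^sub>R y) ` Y. k_connectable A k x y)} \<noteq> {}"
    (is "?K \<noteq> {}")
  proof
    assume "?K = {}"
    then have "hops A Y r x = \<infinity>" unfolding hops_def by (simp only: Inf_enat_def) simp
    then show False using assms by simp
  qed
  then show ?thesis using that by (auto simp: connectable_def)
qed

section \<open>Mass transport\<close>

text \<open>The joint law is the product of the marginal laws, so the two variables may be sampled
  separately, with \<open>w\<close> for \<open>X\<close> and \<open>w'\<close> for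
  \<open>Y\<close>.\<close>

lemma indep_nn_integral:
  assumes M: "prob_space M" and ind: "prob_space.indep_var M S X T Y"
    and G [measurable]: "G \<in> borel_measurable (S \<Otimes>\<^sub>M T)"
  shows "(\<integral>\<^sup>+w. G (X w, Y w) \<partial>M) = (\<integral>\<^sup>+w'. \<integral>\<^sup>+w. G (X w, Y w') \<partial>M \<partial>M)"
proof -
  interpret prob_space M by fact
  have XY [measurable]: "X \<in> measurable M S" "Y \<in> measurable M T"
    and eq: "distr M S X \<Otimes>\<^sub>M distr M T Y = distr M (S \<Otimes>\<^sub>M T) (\<lambda>x. (X x, Y x))"
    using ind by (auto simp: indep_var_distribution_eq)
  interpret DX: prob_space "distr M S X" by (rule prob_space_distr) fact
  interpret DY: prob_space "distr M T Y" by (rule prob_space_distr) fact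
  interpret pair_sigma_finite "distr M S X" "distr M T Y" ..
  have "(\<integral>\<^sup>+w. G (X w, Y w) \<partial>M) = (\<integral>\<^sup>+p. G p \<partial>(distr M S X \<Otimes>\<^sub>M distr M T Y))"
    by (simp add: eq nn_integral_distr)
  also have "\<dots> = (\<integral>\<^sup>+B. \<integral>\<^sup>+A. G (A, B) \<partial>distr M S X \<partial>distr M T Y)"
    by (rule nn_integral_snd[symmetric]) measurable
  also have "\<dots> = (\<integral>\<^sup>+w'. \<integral>\<^sup>+A. G (A, Y w') \<partial>distr M S X \<partial>M)"
    by (rule nn_integral_distr) measurable
  also have "\<dots> = (\<integral>\<^sup>+w'. \<integral>\<^sup>+w. G (X w, Y w') \<partial>M \<partial>M)"
    by (intro nn_integral_cong nn_integral_distr) (use measurable_space[OF XY(2)] in \<open>auto\<close>)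
  finally show ?thesis .
qed

text \<open>A union bound: a counted \<open>x\<close> is connectable to at least one
  \<open>r *\<^sub>R y\<close>, so its indicator is at most the number of such \<open>y\<close>. The
  two sums are then exchanged.\<close>

lemma num_points_hops_le:
  assumes "countable Y"
  shows "num_points {x \<in> A \<inter> Q. hops A Y r x \<le> enat k} \<le>
    (\<integral>\<^sup>+y. \<integral>\<^sup>+x. (if x \<in> Q \<and> connectable A x (r *\<^sub>R y) then 1 else 0) \<partial>count_space A \<partial>count_space Y)"
    (is "_ \<le> (\<integral>\<^sup>+y. \<integral>\<^sup>+x. ?f x y \<partial>_ \<partial>_)")
proof -
  have "num_points {x \<in> A \<inter> Q. hops A Y r x \<le> enat k} =
      (\<integral>\<^sup>+x. (if x \<in> Q \<and> hops A Y r x \<le> enat k then 1 else 0) \<partial>count_space A)"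
    unfolding nn_integral_if_count_space by (rule arg_cong[where f = num_points]) auto
  also have "\<dots> \<le> (\<integral>\<^sup>+x. \<integral>\<^sup>+y. ?f x y \<partial>count_space Y \<partial>count_space A)"
  proof (rule nn_integral_mono)
    fix x
    show "(if x \<in> Q \<and> hops A Y r x \<le> enat k then 1 else 0) \<le> (\<integral>\<^sup>+y. ?f x y \<partial>count_space Y)"
    proof (cases "x \<in> Q \<and> hops A Y r x \<le> enat k")
      case True
      then obtain y where "y \<in> Y" "connectable A x (r *\<^sub>R y)" using hops_leE by blast
      then show ?thesis using True nn_integral_ge_point[of y Y "?f x"] by simp
    next
      case False
      then show ?thesis by (subst if_not_P) simp_all
    qed
  qed
  also have "\<dots> = (\<integral>\<^sup>+y. \<integral>\<^sup>+x. ?f x y \<partial>count_space A \<partial>count_space Y)"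
    using assms by (intro nn_integral_count_space_nn_integral) auto
  finally show ?thesis .
qed

text \<open>The mass transport step: by stationarity the target \<open>y\<close> is moved to the
  origin while the window moves to \<open>Q - y\<close>. Integrating over \<open>y\<close> then
  gives every point of the cluster of the origin the weight
  \<open>emeasure lborel Q\<close>.\<close>

lemma nn_integral_connectable:
  fixes X :: "'w \<Rightarrow> (real ^ 'n) set"
  assumes M: "sigma_finite_measure M" and st: "stationary M X"
    and X [measurable]: "X \<in> measurable M config_space"
    and Q [measurable]: "Q \<in> sets borel"
  shows "(\<integral>\<^sup>+y. \<integral>\<^sup>+w. \<integral>\<^sup>+x. (if x \<in> Q \<and> connectable (X w) x y then 1 else 0)
      \<partial>count_space (X w) \<partial>M \<partial>lborel) =
    emeasure lborel Q * (\<integral>\<^sup>+w. num_points (cluster (X w) 0) \<partial>M)"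
proof -
  note [measurable] = pred_connectable
  define c :: "(real ^ 'n) set \<times> (real ^ 'n) \<Rightarrow> ennreal"
    where "c = (\<lambda>(A, x). if connectable A x 0 then 1 else 0)"
  define q :: "real ^ 'n \<Rightarrow> ennreal" where "q = indicator Q"
  have [measurable]: "c \<in> borel_measurable (config_space \<Otimes>\<^sub>M borel)"
    unfolding c_def case_prod_beta' by measurable
  have q [measurable]: "q \<in> borel_measurable borel" unfolding q_def by measurable
  have q1: "(\<integral>\<^sup>+y. q (y + x) \<partial>lborel) = emeasure lborel Q" for x
    using nn_integral_lborel_affine[OF q, of 1 x] by (simp add: q_def add.commute)
  have "(\<integral>\<^sup>+w. \<integral>\<^sup>+x. (if x \<in> Q \<and> connectable (X w) x y then 1 else 0) \<partial>count_space (X w) \<partial>M) =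
      (\<integral>\<^sup>+w. \<integral>\<^sup>+x. q (y + x) * c (X w, x) \<partial>count_space (X w) \<partial>M)" for y
  proof -
    have "(\<lambda>A. \<integral>\<^sup>+x. (if x \<in> Q \<and> connectable A x y then 1 else 0) \<partial>count_space A)
        \<in> borel_measurable config_space"
      using measurable_sum_points[of "\<lambda>A. A" config_space
          "\<lambda>p. if fst p \<in> Q \<and> connectable (snd p) (fst p) y then 1 else 0"] by simp
    from stationary_nn_integral[OF st X this, of y]
    have "(\<integral>\<^sup>+w. \<integral>\<^sup>+x. (if x \<in> Q \<and> connectable (X w) x y then 1 else 0) \<partial>count_space (X w) \<partial>M) =
      (\<integral>\<^sup>+w. \<integral>\<^sup>+x. (if y + x \<in> Q \<and> connectable ((+) y ` X w) (y + x) (y + 0) then 1 else 0)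
        \<partial>count_space (X w) \<partial>M)"
      by (simp add: sum_points_translate)
    also have "\<dots> = (\<integral>\<^sup>+w. \<integral>\<^sup>+x. q (y + x) * c (X w, x) \<partial>count_space (X w) \<partial>M)"
      unfolding connectable_translate by (intro nn_integral_cong) (auto simp: q_def c_def)
    finally show ?thesis .
  qed
  then have "(\<integral>\<^sup>+y. \<integral>\<^sup>+w. \<integral>\<^sup>+x. (if x \<in> Q \<and> connectable (X w) x y then 1 else 0)
        \<partial>count_space (X w) \<partial>M \<partial>lborel) =
      (\<integral>\<^sup>+y. \<integral>\<^sup>+w. \<integral>\<^sup>+x. q (y + x) * c (X w, x) \<partial>count_space (X w) \<partial>M \<partial>lborel)"
    by simp
  also have "\<dots> = (\<integral>\<^sup>+w. \<integral>\<^sup>+x. \<integral>\<^sup>+y. q (y + x) * c (X w, x) \<partial>lborel \<partial>count_space (X w) \<partial>M)"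
    using nn_integral_sum_points_swap[OF M sigma_finite_lborel X,
        where F = "\<lambda>(x, y, w). q (y + x) * c (X w, x)"] by simp
  also have "\<dots> = (\<integral>\<^sup>+w. emeasure lborel Q * (\<integral>\<^sup>+x. c (X w, x) \<partial>count_space (X w)) \<partial>M)"
    by (simp add: nn_integral_multc q1 nn_integral_cmult)
  also have "\<dots> = emeasure lborel Q * (\<integral>\<^sup>+w. \<integral>\<^sup>+x. c (X w, x) \<partial>count_space (X w) \<partial>M)"
    using measurable_sum_points[OF X, of "\<lambda>p. c (X (snd p), fst p)"]
    by (intro nn_integral_cmult) simp
  also have "(\<lambda>w. \<integral>\<^sup>+x. c (X w, x) \<partial>count_space (X w)) = (\<lambda>w. num_points (cluster (X w) 0))"
    by (simp add: c_def nn_integral_if_count_space cluster_def)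
  finally show ?thesis .
qed

theorem theorem2:
  fixes M :: "'w measure"
    and X Y1 :: "'w \<Rightarrow> (real ^ 'n) set"
    and lam lam' r :: real
  assumes "CARD('n) \<ge> 2"
    and "0 < lam" and "ereal lam < critical_intensity TYPE('n)"
    and "poisson_process M lam X"
    and "point_process M Y1" and "stationary M Y1" and "ergodic M Y1"
    and "prob_space.indep_var M config_space X config_space Y1"
    and "0 < lam'" and "intensity M Y1 = ennreal lam'"
    and "0 < r"
  shows "(SUP k\<in>{1..}. Theta M lam X Y1 k r) \<le>
    ennreal (inverse lam * inverse (r ^ CARD('n)) * lam') * (\<integral>\<^sup>+ w. num_points (cluster (X w) 0) \<partial>M)"
proof (rule SUP_least)
  fix k :: nat
  interpret prob_space M using assms(5) by (simp add: point_process_def)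
  note M = sigma_finite_measure_axioms
  have X [measurable]: "X \<in> measurable M config_space"
    and Y [measurable]: "Y1 \<in> measurable M config_space"
    using assms(4,5) by (simp_all add: poisson_process_def point_process_def)
  have Yc: "countable (Y1 w)" if "w \<in> space M" for w
    using measurable_space[OF Y that] by (simp add: space_config_space countable_locally_finite)
  note [measurable] = pred_connectable
  define Q :: "(real ^ 'n) set" where "Q = cbox (\<chi> i. - 1/2) (\<chi> i. 1/2)"
  have Q [measurable]: "Q \<in> sets borel" by (simp add: Q_def)
  define h :: "(real ^ 'n) set \<times> (real ^ 'n) \<Rightarrow> ennreal" where
    "h = (\<lambda>(A, y). \<integral>\<^sup>+x. (if x \<in> Q \<and> connectable A x y then 1 else 0) \<partial>count_space A)"
  have [measurable]: "h \<in> borel_measurable (config_space \<Otimes>\<^sub>M borel)"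
    using measurable_sum_points[of fst "config_space \<Otimes>\<^sub>M borel"
        "\<lambda>p. if fst p \<in> Q \<and> connectable (fst (snd p)) (fst p) (snd (snd p)) then 1 else 0"]
    by (simp add: h_def case_prod_beta')
  \<comment> \<open>The mean over \<open>X\<close> alone for a deterministic target
    \<open>y\<close>; it appears once independence has separated the two processes.\<close>
  define H where "H y = (\<integral>\<^sup>+w. h (X w, y) \<partial>M)" for y
  have H [measurable]: "H \<in> borel_measurable borel"
    unfolding H_def[abs_def] by measurable
  have "(\<integral>\<^sup>+w. num_points {x \<in> X w \<inter> Q. hops (X w) (Y1 w) r x \<le> enat k} \<partial>M) \<le>
      (\<integral>\<^sup>+w. \<integral>\<^sup>+y. h (X w, r *\<^sub>R y) \<partial>count_space (Y1 w) \<partial>M)"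
    unfolding h_def prod.case by (intro nn_integral_mono num_points_hops_le Yc)
  also have "\<dots> = (\<integral>\<^sup>+w'. \<integral>\<^sup>+w. \<integral>\<^sup>+y. h (X w, r *\<^sub>R y) \<partial>count_space (Y1 w') \<partial>M \<partial>M)"
  proof -
    have "(\<lambda>p. \<integral>\<^sup>+y. h (fst p, r *\<^sub>R y) \<partial>count_space (snd p))
        \<in> borel_measurable (config_space \<Otimes>\<^sub>M config_space)"
      using measurable_sum_points[of snd "config_space \<Otimes>\<^sub>M config_space"
          "\<lambda>q. h (fst (snd q), r *\<^sub>R fst q)"] by simp
    from indep_nn_integral[OF prob_space_axioms assms(8) this] show ?thesis by simp
  qed
  \<comment> \<open>For fixed \<open>w'\<close> the set \<open>Y1 w'\<close> is countable, so its
    sum can be taken outside the expectation over \<open>w\<close>.\<close>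
  also have "\<dots> = (\<integral>\<^sup>+w'. \<integral>\<^sup>+y. H (r *\<^sub>R y) \<partial>count_space (Y1 w') \<partial>M)"
    unfolding H_def by (intro nn_integral_cong nn_integral_count_space_nn_integral Yc) measurable
  also have "\<dots> = ennreal lam' * (\<integral>\<^sup>+y. H (r *\<^sub>R y) \<partial>lborel)"
    using campbell[OF M assms(6) Y, of "\<lambda>y. H (r *\<^sub>R y)"] assms(10) by simp
  \<comment> \<open>Scaling by \<open>r\<close> in dimension \<open>CARD('n)\<close> produces the
    factor \<open>r\<close> to the power \<open>- d\<close> of the bound.\<close>
  also have "(\<integral>\<^sup>+y. H (r *\<^sub>R y) \<partial>lborel) = ennreal (inverse (r ^ CARD('n))) * (\<integral>\<^sup>+y. H y \<partial>lborel)"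
  proof -
    have "(\<integral>\<^sup>+y. H y \<partial>lborel) = ennreal (r ^ CARD('n)) * (\<integral>\<^sup>+y. H (r *\<^sub>R y) \<partial>lborel)"
      using nn_integral_lborel_affine[OF H, of r 0] assms(11) by simp
    then show ?thesis
      using assms(11) by (simp add: mult.assoc[symmetric] ennreal_mult'[symmetric])
  qed
  \<comment> \<open>The centred cube \<open>Q\<close> has volume 1, so only the expected cluster
    size remains.\<close>
  also have "(\<integral>\<^sup>+y. H y \<partial>lborel) = (\<integral>\<^sup>+w. num_points (cluster (X w) 0) \<partial>M)"
    using nn_integral_connectable[OF M poisson_process_stationary[OF assms(4)] X Q]
      emeasure_lborel_unit_cube[of "1/2" "-1/2", where 'n='n]
    by (simp add: H_def h_def Q_def)
  finally have "Theta M lam X Y1 k r \<le> ennreal (inverse lam) * (ennreal lam' *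
      (ennreal (inverse (r ^ CARD('n))) * (\<integral>\<^sup>+w. num_points (cluster (X w) 0) \<partial>M)))"
    unfolding Theta_def Q_def by (rule mult_left_mono) simp
  also have "\<dots> = ennreal (inverse lam * inverse (r ^ CARD('n)) * lam') *
      (\<integral>\<^sup>+w. num_points (cluster (X w) 0) \<partial>M)"
    using assms(2,9,11) by (simp add: ennreal_mult mult_ac)
  finally show "Theta M lam X Y1 k r \<le> ennreal (inverse lam * inverse (r ^ CARD('n)) * lam') *
      (\<integral>\<^sup>+w. num_points (cluster (X w) 0) \<partial>M)" .
qed

end
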